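(* Let $m\geqslant 1$ and let $k_1,\dots,k_m$, $h_1,\dots,h_m$ be integers with $k_{i+1}\geqslant k_i$ and $h_{i+1}\geqslant h_i$ for $i=1,\dots,m-1$, and $k_j\geqslant h_j$ for $j=1,\dots,m$, for which $CHS(\{k_s;h_s\}_{s=1}^m)$ is a monotonic constructable hexagonal system (so $h_1=1$ and $h_{i+1}\leqslant k_i$ for $i=1,\dots,m-1$). Write $F(\{k_s;h_s\}_{s=1}^{m})$ for its forcing polynomial in the variable $x$. Then $$F(\{k_s;h_s\}_{s=1}^{m})=\sum_{i=h_m-1}^{k_m-1}F(\{\min\{k_s,i\};h_s\}_{s=1}^{m-1})\,x+\sum_{j=p}^{m}F(\{\min\{k_s,k_m-1\};h_s\}_{s=1}^{j-1})\,x,$$ where $p=\min\{s:k_s=k_m\}$, and where by convention $F(\{b_s;d_s\}_{s=1}^{i})=F(\{b_s;d_s\}_{s=1}^{i-1})$ if $b_i<d_i$ and $i\geqslant 1$, and $F(\{b_s;d_s\}_{s=1}^{j})=1$ if $j=0$.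
   Context: Forcing polynomial. A perfect matching $M$ of a graph $G$ is a set of disjoint edges covering all vertices of $G$. A forcing set of $M$ is a subset $S\subseteq M$ that is contained in no other perfect matching of $G$. The forcing number $f(G,M)$ is the smallest cardinality of a forcing set of $M$. The forcing polynomial of $G$ is $F(G,x)=\sum_{M}x^{f(G,M)}$, the sum being over all perfect matchings $M$ of $G$. Monotonic CHS. A hexagonal system is a 2-connected finite plane graph in which every interior face is a regular hexagon. Consider the regular hexagonal tiling of the plane with hexagons of side length $\sqrt3/3$ placed so that each hexagon has two vertical edges (so centers of adjacent hexagons are at distance $1$). For integers $i,j$ let $C_{i,j}$ be the hexagon of the tiling with center $\left(-\frac{i-1}{2}-(j-1),\,-\frac{\sqrt3}{2}(i-1)\right)$; thus $C_{i,j+1}$ is the left neighbour of $C_{i,j}$, $C_{i+1,j}$ is its lower-left neighbour, and $C_{i+1,j-1}$ is its lower-right neighbour. The (left-)monotonic constructable hexagonal system $CHS(k_1,\dots,k_m;h_1,\dots,h_m)$, briefly $CHS(\{k_s;h_s\}_{s=1}^m)$, is the hexagonal system (plane graph) formed by the vertices and edges of the hexagons $C_{i,j}$ with $1\leqslant i\leqslant m$ and $h_i\leqslant j\leqslant k_i$; its $i$th row (from the top) is the linear chain of hexagons from $C_{i,k_i}$ (leftmost) to $C_{i,h_i}$ (rightmost), and the top right corner hexagon is $C_{1,1}$, i.e. $h_1=1$. Notation: $F(\{k_s;h_s\}_{s=1}^{m})=F(CHS(\{k_s;h_s\}_{s=1}^{m}),x)$. For arrays with empty last rows, $CHS(\{b_s;d_s\}_{s=1}^{i})=CHS(\{b_s;d_s\}_{s=1}^{i-1})$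 if $b_i<d_i$ and $i\geqslant 1$, and $CHS(\{b_s;d_s\}_{s=1}^{j})$ is the empty graph if $j=0$ (with forcing polynomial $1$). *)

theory Defs
  imports Complex_Main "HOL-Library.Product_Plus" "HOL-Computational_Algebra.Polynomial"
begin

text \<open>A graph is a pair of a vertex set and a set of edges, each edge being the set of its two ends.\<close>

type_synonym 'a ugraph = "'a set \<times> 'a set set"

definition perfect_matching :: "'a ugraph \<Rightarrow> 'a set set \<Rightarrow> bool" where
  "perfect_matching G M \<longleftrightarrow> M \<subseteq> snd G \<and> pairwise disjnt M \<and> \<Union>M = fst G"

definition forcing_set :: "'a ugraph \<Rightarrow> 'a set set \<Rightarrow> 'a set set \<Rightarrow> bool" where
  "forcing_set G M S \<longleftrightarrow> S \<subseteq> M \<and> \<not> (\<exists>M'. perfect_matching G M' \<and> M' \<noteq> M \<and> S \<subseteq> M')"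

definition forcing_number :: "'a ugraph \<Rightarrow> 'a set set \<Rightarrow> nat" where
  "forcing_number G M = (LEAST n. \<exists>S. forcing_set G M S \<and> finite S \<and> card S = n)"

definition forcing_polynomial :: "'a ugraph \<Rightarrow> int poly" where
  "forcing_polynomial G = (\<Sum>M | perfect_matching G M. monom 1 (forcing_number G M))"

definition hex_center :: "int \<Rightarrow> int \<Rightarrow> real \<times> real" where
  "hex_center i j =
     (- (of_int i - 1) / 2 - (of_int j - 1), - (sqrt 3 / 2) * (of_int i - 1))"

text \<open>The corners of a regular hexagon of side \<open>sqrt 3 / 3\<close> with two vertical edges, relative to
  its center, listed clockwise from the topmost one.\<close>

definition hex_offsets :: "(real \<times> real) list" where
  "hex_offsets =
     [(0, sqrt 3 / 3), (1/2, sqrt 3 / 6), (1/2, - sqrt 3 / 6),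
      (0, - sqrt 3 / 3), (- 1/2, - sqrt 3 / 6), (- 1/2, sqrt 3 / 6)]"

definition hex_corner :: "int \<Rightarrow> int \<Rightarrow> nat \<Rightarrow> real \<times> real" where
  "hex_corner i j t = hex_center i j + hex_offsets ! (t mod 6)"

definition hex_vertices :: "int \<Rightarrow> int \<Rightarrow> (real \<times> real) set" where
  "hex_vertices i j = {hex_corner i j t |t. t < 6}"

definition hex_edges :: "int \<Rightarrow> int \<Rightarrow> (real \<times> real) set set" where
  "hex_edges i j = {{hex_corner i j t, hex_corner i j (Suc t)} |t. t < 6}"

text \<open>\<open>CHS m k h\<close> has rows \<open>1, \<dots>, m\<close>; row \<open>i\<close> consists of the hexagons in columns
  \<open>h i, \<dots>, k i\<close>. A row with \<open>k i < h i\<close> contributes nothing, which yields the conventions on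
  empty last rows and on the empty graph (see the lemmas below).\<close>

definition CHS :: "nat \<Rightarrow> (nat \<Rightarrow> int) \<Rightarrow> (nat \<Rightarrow> int) \<Rightarrow> (real \<times> real) ugraph" where
  "CHS m k h =
     (\<Union>i\<in>{1..m}. \<Union>j\<in>{h i..k i}. hex_vertices (int i) j,
      \<Union>i\<in>{1..m}. \<Union>j\<in>{h i..k i}. hex_edges (int i) j)"

definition CHS_poly :: "nat \<Rightarrow> (nat \<Rightarrow> int) \<Rightarrow> (nat \<Rightarrow> int) \<Rightarrow> int poly" where
  "CHS_poly m k h = forcing_polynomial (CHS m k h)"

lemma CHS_poly_empty_last_row:
  assumes "m \<ge> 1" and "k m < h m"
  shows "CHS_poly m k h = CHS_poly (m - 1) k h"
proof -
  have "{1..m} = insert m {1..m - 1}"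
    using assms(1) by auto
  then have "CHS m k h = CHS (m - 1) k h"
    using assms(2) by (simp add: CHS_def)
  then show ?thesis
    by (simp add: CHS_poly_def)
qed

lemma CHS_poly_0: "CHS_poly 0 k h = 1"
proof -
  let ?G = "({}, {}) :: (real \<times> real) ugraph"
  have pm: "{M. perfect_matching ?G M} = {{}}"
    by (auto simp: perfect_matching_def)
  have "forcing_set ?G {} {}"
    by (auto simp: forcing_set_def perfect_matching_def)
  then have "forcing_number ?G {} = 0"
    unfolding forcing_number_def
    by (intro Least_eq_0 exI[of _ "{}"]) auto
  then have "forcing_polynomial ?G = 1"
    by (simp add: forcing_polynomial_def pm)
  then show ?thesis
    by (simp add: CHS_poly_def CHS_def)
qed

end

theory Submission
  imports Defs
begin

text \<open>
  A perfect matching of the system contains exactly one vertical edge in each row of hexagons, and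
  the columns \<open>a 1 \<le> \<dots> \<le> a m\<close> of these vertical edges form a weakly increasing sequence with
  \<open>h i - 1 \<le> a i \<le> k i\<close>. Conversely, each such sequence determines the matching, because what
  remains between two consecutive rows is a zigzag path without the lower end of one vertical edge
  and the upper end of another, and such a path has at most one perfect matching (\<open>zigzag_path\<close>,
  \<open>perfect_matching_CHS_iff_path_matching\<close>). Matchings are thus monotone lattice paths, and the
  hexagons in which a matching alternates are turns of the path.

  Let \<open>K = k m\<close>. The path is classified by its last turn inside the system. If \<open>a m = i < K\<close>,
  then the hexagon in column \<open>i + 1\<close> of the last row is alternating, and the vertical edge in
  column \<open>i\<close> of the last row singles out this class. If \<open>a m = K\<close> and \<open>j\<close> is the first row with
  \<open>a j = K\<close>, then the hexagon in column \<open>K\<close> of row \<open>j\<close> is alternating, and its upper right edge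
  singles out this class: it says precisely that \<open>a (j - 1) < K\<close> and \<open>a j = K\<close>. In both cases the
  rows below the turn are determined, and the rows above it range over all perfect matchings of a
  system truncated at column \<open>i\<close>, respectively \<open>K - 1\<close>, none of whose edges lies in the
  alternating hexagon.

  Therefore each matching of the class has forcing number one more than its restriction to the
  truncated system (\<open>sum_matchings_containing_edge\<close>). The class edge together with a forcing set of
  the restriction is forcing. Conversely, a forcing set restricts to a forcing set of the truncated
  system, and it needs one more edge, since otherwise the alternating hexagon could be rotated.
  Summing over all classes gives the recurrence.
\<close>

section \<open>Splitting off a matching by one edge\<close>

lemma perfect_matching_subset_imp_eq:
  assumes "perfect_matching G M" "perfect_matching G M'" "M \<subseteq> M'" "{} \<notin> snd G"
  shows "M = M'"
proof (rule ccontr)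
  assume "M \<noteq> M'"
  with assms(3) obtain e where e: "e \<in> M'" "e \<notin> M" by blast
  have "e \<noteq> {}" using e assms by (auto simp: perfect_matching_def)
  then obtain v where v: "v \<in> e" by blast
  then have "v \<in> \<Union>M" using e assms(1,2) by (auto simp: perfect_matching_def)
  then obtain e' where "e' \<in> M" "v \<in> e'" by blast
  then have "e' \<in> M'" "e' \<noteq> e" "\<not> disjnt e e'" using e v assms(3) by (auto simp: disjnt_iff)
  then show False using e assms(2) unfolding perfect_matching_def pairwise_def by metis
qed

lemma forcing_number_attained:
  assumes "perfect_matching G M" "finite (snd G)" "{} \<notin> snd G"
  obtains S where "forcing_set G M S" "finite S" "card S = forcing_number G M"
proof -
  have "finite M" using assms(1,2) by (auto simp: perfect_matching_def intro: finite_subset)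
  moreover have "forcing_set G M M"
    using perfect_matching_subset_imp_eq[OF assms(1) _ _ assms(3)] by (auto simp: forcing_set_def)
  ultimately have "\<exists>n S. forcing_set G M S \<and> finite S \<and> card S = n" by blast
  from LeastI_ex[OF this] that show thesis unfolding forcing_number_def by blast
qed

lemma forcing_number_le:
  "forcing_set G M S \<Longrightarrow> finite S \<Longrightarrow> forcing_number G M \<le> card S"
  unfolding forcing_number_def by (rule Least_le) blast

text \<open>The edge \<open>e\<close> stands for a class of perfect matchings that agree outside a subgraph \<open>G'\<close> and
  restrict to all perfect matchings of \<open>G'\<close>. Adding \<open>e\<close> to a forcing set of the restriction forces
  the whole matching. The assumption \<open>change\<close> says that the part outside \<open>G'\<close> is never forced by
  the part inside, so that every forcing set spends at least one edge outside \<open>G'\<close>. Together these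
  give a forcing number that is larger by exactly one.\<close>

lemma sum_matchings_containing_edge:
  assumes fin: "finite (snd G)" and ne: "{} \<notin> snd G" and sub: "snd G' \<subseteq> snd G"
    and restr: "\<And>M. perfect_matching G M \<Longrightarrow> e \<in> M \<Longrightarrow> perfect_matching G' (M \<inter> snd G')"
    and outside: "\<And>M N. \<lbrakk>perfect_matching G M; e \<in> M; perfect_matching G N; e \<in> N\<rbrakk>
                    \<Longrightarrow> M - snd G' = N - snd G'"
    and extend: "\<And>M'. perfect_matching G' M'
                    \<Longrightarrow> \<exists>M. perfect_matching G M \<and> e \<in> M \<and> M \<inter> snd G' = M'"
    and change: "\<And>M. perfect_matching G M \<Longrightarrow> e \<in> M
                    \<Longrightarrow> \<exists>N. perfect_matching G N \<and> N \<noteq> M \<and> M \<inter> snd G' \<subseteq> N"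
  shows "(\<Sum>M | perfect_matching G M \<and> e \<in> M. monom 1 (forcing_number G M))
           = forcing_polynomial G' * [:0, 1:]"
proof -
  have fin': "finite (snd G')" and ne': "{} \<notin> snd G'"
    using fin ne sub by (auto intro: finite_subset)
  have fn: "forcing_number G M = Suc (forcing_number G' (M \<inter> snd G'))"
    if M: "perfect_matching G M" "e \<in> M" for M
  proof (rule antisym)
    obtain S where S: "forcing_set G' (M \<inter> snd G') S" "finite S"
        "card S = forcing_number G' (M \<inter> snd G')"
      using forcing_number_attained[OF restr[OF M] fin' ne'] .
    have "forcing_set G M (insert e S)"
      unfolding forcing_set_def
    proof (intro conjI notI)
      show "insert e S \<subseteq> M" using S M by (auto simp: forcing_set_def)
    next
      assume "\<exists>N. perfect_matching G N \<and> N \<noteq> M \<and> insert e S \<subseteq> N"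
      then obtain N where N: "perfect_matching G N" "N \<noteq> M" "insert e S \<subseteq> N" by blast
      have "S \<subseteq> N \<inter> snd G'" using S N by (auto simp: forcing_set_def)
      then have "N \<inter> snd G' = M \<inter> snd G'"
        using S(1) restr[OF N(1)] N(3) by (auto simp: forcing_set_def)
      moreover have "N - snd G' = M - snd G'" using outside N M by blast
      ultimately show False using N(2) by blast
    qed
    then have "forcing_number G M \<le> card (insert e S)"
      using S by (intro forcing_number_le) auto
    also have "\<dots> \<le> Suc (card S)" by (rule card_insert_le_m1) auto
    finally show "forcing_number G M \<le> Suc (forcing_number G' (M \<inter> snd G'))"
      using S by simp
  next
    obtain S where S: "forcing_set G M S" "finite S" "card S = forcing_number G M"
      using forcing_number_attained[OF M(1) fin ne] .
    have "forcing_set G' (M \<inter> snd G') (S \<inter> snd G')"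
      unfolding forcing_set_def
    proof (intro conjI notI)
      show "S \<inter> snd G' \<subseteq> M \<inter> snd G'" using S by (auto simp: forcing_set_def)
    next
      assume "\<exists>N'. perfect_matching G' N' \<and> N' \<noteq> M \<inter> snd G' \<and> S \<inter> snd G' \<subseteq> N'"
      then obtain N' where N': "perfect_matching G' N'" "N' \<noteq> M \<inter> snd G'" "S \<inter> snd G' \<subseteq> N'"
        by blast
      obtain N where N: "perfect_matching G N" "e \<in> N" "N \<inter> snd G' = N'"
        using extend[OF N'(1)] by blast
      have "N - snd G' = M - snd G'" using outside N M by blast
      then have "S \<subseteq> N" using S N N' by (auto simp: forcing_set_def)
      then show False using S(1) N N'(2) by (auto simp: forcing_set_def)
    qed
    then have "forcing_number G' (M \<inter> snd G') \<le> card (S \<inter> snd G')"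
      using S by (intro forcing_number_le) auto
    moreover have "S \<inter> snd G' \<subset> S"
    proof -
      obtain N where "perfect_matching G N" "N \<noteq> M" "M \<inter> snd G' \<subseteq> N"
        using change[OF M] by blast
      then show ?thesis using S(1) unfolding forcing_set_def by blast
    qed
    then have "card (S \<inter> snd G') < card S" using S(2) by (rule psubset_card_mono[rotated])
    ultimately show "Suc (forcing_number G' (M \<inter> snd G')) \<le> forcing_number G M"
      using S by simp
  qed
  have "bij_betw (\<lambda>M. M \<inter> snd G') {M. perfect_matching G M \<and> e \<in> M} {M'. perfect_matching G' M'}"
    unfolding bij_betw_def
  proof
    show "inj_on (\<lambda>M. M \<inter> snd G') {M. perfect_matching G M \<and> e \<in> M}"
      using outside by (intro inj_onI) blast
    show "(\<lambda>M. M \<inter> snd G') ` {M. perfect_matching G M \<and> e \<in> M} = {M'. perfect_matching G' M'}"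
      using restr extend by fast
  qed
  then have "(\<Sum>M | perfect_matching G M \<and> e \<in> M.
        monom 1 (Suc (forcing_number G' (M \<inter> snd G')))) =
      (\<Sum>M' | perfect_matching G' M'. monom (1::int) (Suc (forcing_number G' M')))"
    by (rule sum.reindex_bij_betw)
  also have "\<dots> = forcing_polynomial G' * [:0, 1:]"
    by (simp only: forcing_polynomial_def sum_distrib_right monom_Suc) simp
  finally show ?thesis by (simp add: fn)
qed

lemma perfect_matching_iff_unique_edge:
  assumes "\<Union>(snd G) \<subseteq> fst G" "{} \<notin> snd G"
  shows "perfect_matching G M \<longleftrightarrow> M \<subseteq> snd G \<and> (\<forall>v\<in>fst G. \<exists>!e. e \<in> M \<and> v \<in> e)"
proof
  assume "perfect_matching G M"
  then show "M \<subseteq> snd G \<and> (\<forall>v\<in>fst G. \<exists>!e. e \<in> M \<and> v \<in> e)"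
    unfolding perfect_matching_def pairwise_def disjnt_iff by blast
next
  assume "M \<subseteq> snd G \<and> (\<forall>v\<in>fst G. \<exists>!e. e \<in> M \<and> v \<in> e)"
  then show "perfect_matching G M"
    using assms unfolding perfect_matching_def pairwise_def disjnt_iff by blast
qed

section \<open>Vertices and edges of the hexagonal tiling\<close>

text \<open>Row \<open>i\<close> of hexagons has vertical edges in columns \<open>h i - 1, \<dots>, k i\<close>, the one in column \<open>j\<close>
  being the left side of the hexagon in column \<open>j\<close> and the right side of the one in column \<open>j + 1\<close>.
  Its ends are \<open>upp i j\<close> and \<open>low i j\<close>, and every vertex of the system has exactly one of these
  two forms. Between rows \<open>i\<close> and \<open>i + 1\<close> runs, from right to left, the zigzag path
  \<open>low i j, upp (i + 1) j, low i (j + 1), \<dots>\<close> with edges \<open>fall\<close> (going down) and \<open>rise\<close> (going up)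
  in alternation; \<open>i = 0\<close> gives the upper boundary of the first row.\<close>

definition low :: "nat \<Rightarrow> int \<Rightarrow> real \<times> real" where
  "low i j = hex_corner (int i) j 4"

definition upp :: "nat \<Rightarrow> int \<Rightarrow> real \<times> real" where
  "upp i j = hex_corner (int i) j 5"

definition vert :: "nat \<Rightarrow> int \<Rightarrow> (real \<times> real) set" where
  "vert i j = {upp i j, low i j}"

definition fall :: "nat \<Rightarrow> int \<Rightarrow> (real \<times> real) set" where
  "fall i j = {low i j, upp (Suc i) j}"

definition rise :: "nat \<Rightarrow> int \<Rightarrow> (real \<times> real) set" where
  "rise i j = {upp (Suc i) j, low i (j + 1)}"

lemma low_eq: "low i j = (- real i / 2 - of_int j + 1, sqrt 3 * (1 / 3 - real i / 2))"
  by (simp add: low_def hex_corner_def hex_center_def hex_offsets_def field_simps)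

lemma upp_eq: "upp i j = (- real i / 2 - of_int j + 1, sqrt 3 * (2 / 3 - real i / 2))"
  by (simp add: upp_def hex_corner_def hex_center_def hex_offsets_def field_simps)

lemma low_inject [simp]: "low i j = low i' j' \<longleftrightarrow> i = i' \<and> j = j'"
  by (auto simp: low_eq)

lemma upp_inject [simp]: "upp i j = upp i' j' \<longleftrightarrow> i = i' \<and> j = j'"
  by (auto simp: upp_eq)

lemma low_neq_upp [simp]: "low i j \<noteq> upp i' j'" "upp i' j' \<noteq> low i j"
proof -
  have "1 / 3 - real i / 2 \<noteq> 2 / 3 - real i' / 2"
  proof
    \<comment> \<open>Clearing denominators in the vertical coordinates gives a contradiction modulo 3.\<close>
    assume "1 / 3 - real i / 2 = 2 / 3 - real i' / 2"
    then have "real (3 * i') = real (3 * i + 2)" by simp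
    then have "3 * i' = 3 * i + 2" by (simp only: of_nat_eq_iff)
    then show False by presburger
  qed
  then show "low i j \<noteq> upp i' j'" by (simp add: low_eq upp_eq)
  then show "upp i' j' \<noteq> low i j" by metis
qed

lemma edge_inject [simp]:
  "vert i j = vert i' j' \<longleftrightarrow> i = i' \<and> j = j'"
  "fall i j = fall i' j' \<longleftrightarrow> i = i' \<and> j = j'"
  "rise i j = rise i' j' \<longleftrightarrow> i = i' \<and> j = j'"
  "vert i j \<noteq> fall i' j'" "fall i' j' \<noteq> vert i j"
  "vert i j \<noteq> rise i' j'" "rise i' j' \<noteq> vert i j"
  "fall i j \<noteq> rise i' j'" "rise i' j' \<noteq> fall i j"
  by (auto simp: vert_def fall_def rise_def doubleton_eq_iff)

lemma in_edge [simp]: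
  "low i j \<in> vert i' j' \<longleftrightarrow> i = i' \<and> j = j'"
  "low i j \<in> fall i' j' \<longleftrightarrow> i = i' \<and> j = j'"
  "low i j \<in> rise i' j' \<longleftrightarrow> i = i' \<and> j = j' + 1"
  "upp i j \<in> vert i' j' \<longleftrightarrow> i = i' \<and> j = j'"
  "upp i j \<in> fall i' j' \<longleftrightarrow> i = Suc i' \<and> j = j'"
  "upp i j \<in> rise i' j' \<longleftrightarrow> i = Suc i' \<and> j = j'"
  by (auto simp: vert_def fall_def rise_def)

lemma less_6_iff: "t < 6 \<longleftrightarrow> t = 0 \<or> t = 1 \<or> t = 2 \<or> t = 3 \<or> t = 4 \<or> t = (5::nat)"
  by auto

lemma hex_corner_eqs:
  "hex_corner (int (Suc i)) j 0 = low i j"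
  "hex_corner (int (Suc i)) j 1 = upp (Suc i) (j - 1)"
  "hex_corner (int (Suc i)) j 2 = low (Suc i) (j - 1)"
  "hex_corner (int (Suc i)) j 3 = upp (Suc (Suc i)) (j - 1)"
  "hex_corner (int (Suc i)) j 4 = low (Suc i) j"
  "hex_corner (int (Suc i)) j 5 = upp (Suc i) j"
  "hex_corner (int (Suc i)) j 6 = low i j"
  unfolding low_eq upp_eq
  by (simp_all add: hex_corner_def hex_center_def hex_offsets_def field_simps)

lemma hex_vertices_Suc: "hex_vertices (int (Suc i)) j =
   {low i j, upp (Suc i) (j - 1), low (Suc i) (j - 1),
    upp (Suc (Suc i)) (j - 1), low (Suc i) j, upp (Suc i) j}"
proof -
  have "hex_vertices (int (Suc i)) j = hex_corner (int (Suc i)) j ` {0, 1, 2, 3, 4, 5}"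
    unfolding hex_vertices_def less_6_iff by blast
  then show ?thesis by (simp only: image_insert image_empty hex_corner_eqs)
qed

lemma hex_edges_Suc: "hex_edges (int (Suc i)) j =
   {rise i (j - 1), vert (Suc i) (j - 1), fall (Suc i) (j - 1),
    rise (Suc i) (j - 1), vert (Suc i) j, fall i j}"
proof -
  have "hex_edges (int (Suc i)) j =
      (\<lambda>t. {hex_corner (int (Suc i)) j t, hex_corner (int (Suc i)) j (Suc t)}) ` {0, 1, 2, 3, 4, 5}"
    unfolding hex_edges_def less_6_iff by blast
  moreover have "Suc 0 = 1" "Suc 1 = 2" "Suc 2 = 3" "Suc 3 = 4" "Suc 4 = 5" "Suc 5 = 6" by auto
  ultimately show ?thesis
    by (simp only: image_insert image_empty hex_corner_eqs vert_def fall_def rise_def)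
       (simp add: insert_commute)
qed

lemma CHS_rows:
  "fst (CHS m k h) = (\<Union>r<m. \<Union>j\<in>{h (Suc r)..k (Suc r)}. hex_vertices (int (Suc r)) j)"
  "snd (CHS m k h) = (\<Union>r<m. \<Union>j\<in>{h (Suc r)..k (Suc r)}. hex_edges (int (Suc r)) j)"
proof -
  have "{1..m} = Suc ` {..<m}" by (simp add: image_Suc_lessThan)
  then show
    "fst (CHS m k h) = (\<Union>r<m. \<Union>j\<in>{h (Suc r)..k (Suc r)}. hex_vertices (int (Suc r)) j)"
    "snd (CHS m k h) = (\<Union>r<m. \<Union>j\<in>{h (Suc r)..k (Suc r)}. hex_edges (int (Suc r)) j)"
    by (simp_all add: CHS_def)
qed

lemma int_eq_pred_iff: "i = j - 1 \<longleftrightarrow> j = i + (1::int)"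
  by auto

text \<open>A vertex or an edge of the zigzag path below row \<open>i\<close> comes from a hexagon of row \<open>i\<close>, above the
  path, or from one of row \<open>i + 1\<close>, below it. This is the reason for the two cases here and in the
  analogous lemmas.\<close>

lemma low_in_CHS:
  "low i j \<in> fst (CHS m k h) \<longleftrightarrow>
     (1 \<le> i \<and> i \<le> m \<and> h i \<le> k i \<and> h i - 1 \<le> j \<and> j \<le> k i) \<or>
     (i < m \<and> h (Suc i) \<le> j \<and> j \<le> k (Suc i))"
  unfolding CHS_rows hex_vertices_Suc
  by (cases i) (auto simp: Bex_def ex_disj_distrib conj_disj_distribL conj_disj_distribR int_eq_pred_iff)

lemma upp_in_CHS:
  "upp (Suc i) j \<in> fst (CHS m k h) \<longleftrightarrow>
     (i < m \<and> h (Suc i) \<le> k (Suc i) \<and> h (Suc i) - 1 \<le> j \<and> j \<le> k (Suc i)) \<or>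
     (1 \<le> i \<and> i \<le> m \<and> h i - 1 \<le> j \<and> j < k i)"
  unfolding CHS_rows hex_vertices_Suc
  by (cases i) (auto simp: Bex_def ex_disj_distrib conj_disj_distribL conj_disj_distribR int_eq_pred_iff)

lemma vert_in_CHS:
  "vert i j \<in> snd (CHS m k h) \<longleftrightarrow>
     1 \<le> i \<and> i \<le> m \<and> h i \<le> k i \<and> h i - 1 \<le> j \<and> j \<le> k i"
  unfolding CHS_rows hex_edges_Suc
  by (cases i) (auto simp: Bex_def ex_disj_distrib conj_disj_distribL conj_disj_distribR int_eq_pred_iff)

lemma fall_in_CHS:
  "fall i j \<in> snd (CHS m k h) \<longleftrightarrow>
     (1 \<le> i \<and> i \<le> m \<and> h i - 1 \<le> j \<and> j < k i) \<or>
     (i < m \<and> h (Suc i) \<le> j \<and> j \<le> k (Suc i))"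
  unfolding CHS_rows hex_edges_Suc
  by (cases i) (auto simp: Bex_def ex_disj_distrib conj_disj_distribL conj_disj_distribR int_eq_pred_iff)

lemma rise_in_CHS:
  "rise i j \<in> snd (CHS m k h) \<longleftrightarrow>
     (1 \<le> i \<and> i \<le> m \<and> h i - 1 \<le> j \<and> j < k i) \<or>
     (i < m \<and> h (Suc i) - 1 \<le> j \<and> j < k (Suc i))"
  unfolding CHS_rows hex_edges_Suc
  by (cases i) (auto simp: Bex_def ex_disj_distrib conj_disj_distribL conj_disj_distribR int_eq_pred_iff)

lemma CHS_vertex_cases:
  assumes "v \<in> fst (CHS m k h)"
  obtains i j where "v = low i j" | i j where "v = upp (Suc i) j"
proof -
  from assms obtain r j where "v \<in> hex_vertices (int (Suc r)) j"
    unfolding CHS_rows(1) by blast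
  then show thesis using that unfolding hex_vertices_Suc by (elim insertE emptyE) blast+
qed

lemma CHS_edge_cases:
  assumes "e \<in> snd (CHS m k h)"
  obtains (vert) i j where "e = vert (Suc i) j" | (fall) i j where "e = fall i j"
    | (rise) i j where "e = rise i j"
proof -
  from assms obtain r j where "e \<in> hex_edges (int (Suc r)) j"
    unfolding CHS_rows(2) by blast
  then show thesis using that unfolding hex_edges_Suc by (elim insertE emptyE) blast+
qed

lemma finite_CHS: "finite (snd (CHS m k h))"
  unfolding CHS_rows(2) hex_edges_Suc by auto

lemma empty_notin_CHS: "{} \<notin> snd (CHS m k h)"
  by (auto elim!: CHS_edge_cases simp: vert_def fall_def rise_def)

lemma CHS_edge_ends: "\<Union>(snd (CHS m k h)) \<subseteq> fst (CHS m k h)"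
proof
  fix v assume "v \<in> \<Union>(snd (CHS m k h))"
  then obtain r j e where r: "r < m" "j \<in> {h (Suc r)..k (Suc r)}"
      and e: "e \<in> hex_edges (int (Suc r)) j" "v \<in> e"
    unfolding CHS_rows(2) by auto
  have "v \<in> hex_vertices (int (Suc r)) j"
    using e unfolding hex_edges_Suc hex_vertices_Suc vert_def fall_def rise_def by auto
  with r show "v \<in> fst (CHS m k h)" unfolding CHS_rows(1) by blast
qed

definition exactly_one :: "bool \<Rightarrow> bool \<Rightarrow> bool \<Rightarrow> bool" where
  "exactly_one P Q R \<longleftrightarrow> (P \<and> \<not> Q \<and> \<not> R) \<or> (\<not> P \<and> Q \<and> \<not> R) \<or> (\<not> P \<and> \<not> Q \<and> R)"

lemma ex1_of_three:
  assumes "x \<noteq> y" "x \<noteq> z" "y \<noteq> z" "\<And>e. e \<in> M \<Longrightarrow> P e \<longleftrightarrow> e = x \<or> e = y \<or> e = z"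
  shows "(\<exists>!e. e \<in> M \<and> P e) \<longleftrightarrow> exactly_one (x \<in> M) (y \<in> M) (z \<in> M)"
proof -
  have "(\<exists>!e. e \<in> M \<and> P e) \<longleftrightarrow> (\<exists>!e. e \<in> M \<and> (e = x \<or> e = y \<or> e = z))"
    by (intro arg_cong[where f = Ex1] ext) (use assms(4) in blast)
  also have "\<dots> \<longleftrightarrow> exactly_one (x \<in> M) (y \<in> M) (z \<in> M)"
    using assms(1-3) unfolding exactly_one_def
    by (cases "x \<in> M"; cases "y \<in> M"; cases "z \<in> M") auto
  finally show ?thesis .
qed

lemma perfect_matching_CHS_iff:
  "perfect_matching (CHS m k h) M \<longleftrightarrow> M \<subseteq> snd (CHS m k h) \<and>
     (\<forall>i j. low i j \<in> fst (CHS m k h) \<longrightarrow>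
        exactly_one (vert i j \<in> M) (fall i j \<in> M) (rise i (j - 1) \<in> M)) \<and>
     (\<forall>i j. upp (Suc i) j \<in> fst (CHS m k h) \<longrightarrow>
        exactly_one (vert (Suc i) j \<in> M) (fall i j \<in> M) (rise i j \<in> M))"
  (is "_ \<longleftrightarrow> ?sub \<and> ?low \<and> ?upp")
proof -
  have l: "(\<exists>!e. e \<in> M \<and> low i j \<in> e) \<longleftrightarrow>
      exactly_one (vert i j \<in> M) (fall i j \<in> M) (rise i (j - 1) \<in> M)" if ?sub for i j
  proof (rule ex1_of_three)
    show "low i j \<in> e \<longleftrightarrow> e = vert i j \<or> e = fall i j \<or> e = rise i (j - 1)" if "e \<in> M" for e
    proof -
      have "e \<in> snd (CHS m k h)" using that \<open>?sub\<close> by blast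
      then show ?thesis by (cases rule: CHS_edge_cases) auto
    qed
  qed auto
  have u: "(\<exists>!e. e \<in> M \<and> upp (Suc i) j \<in> e) \<longleftrightarrow>
      exactly_one (vert (Suc i) j \<in> M) (fall i j \<in> M) (rise i j \<in> M)" if ?sub for i j
  proof (rule ex1_of_three)
    show "upp (Suc i) j \<in> e \<longleftrightarrow> e = vert (Suc i) j \<or> e = fall i j \<or> e = rise i j" if "e \<in> M" for e
    proof -
      have "e \<in> snd (CHS m k h)" using that \<open>?sub\<close> by blast
      then show ?thesis by (cases rule: CHS_edge_cases) auto
    qed
  qed auto
  have "(\<forall>v\<in>fst (CHS m k h). \<exists>!e. e \<in> M \<and> v \<in> e) \<longleftrightarrow> ?low \<and> ?upp" if ?sub
  proof -
    have "(\<forall>v\<in>fst (CHS m k h). Q v) \<longleftrightarrow>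
        (\<forall>i j. low i j \<in> fst (CHS m k h) \<longrightarrow> Q (low i j)) \<and>
        (\<forall>i j. upp (Suc i) j \<in> fst (CHS m k h) \<longrightarrow> Q (upp (Suc i) j))" for Q
      by (metis CHS_vertex_cases)
    then show ?thesis by (simp only: l[OF that] u[OF that])
  qed
  then show ?thesis
    unfolding perfect_matching_iff_unique_edge[OF CHS_edge_ends empty_notin_CHS] by blast
qed

section \<open>Perfect matchings as monotone sequences\<close>

text \<open>A matching on the zigzag path between two rows, in terms of \<open>fall\<close> (\<open>D\<close>), \<open>rise\<close> (\<open>R\<close>) and the
  vertical edges hanging from the path (\<open>v\<close>); the only vertical edge coming from above is in column
  \<open>a\<close>. Following the path from the right, the matching must use \<open>D\<close> before column \<open>a\<close>. There it is
  shifted to \<open>R\<close>, unless \<open>v a\<close> holds, and it can return to \<open>D\<close> only by leaving the vertex of some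
  column \<open>b \<ge> a\<close> to the vertical edge below. As it uses \<open>D\<close> from then on, this happens only once.\<close>

lemma zigzag_path:
  fixes D R v :: "int \<Rightarrow> bool"
  assumes a: "lo \<le> a" "a \<le> hi"
    and lower: "\<And>j. lo \<le> j \<Longrightarrow> j \<le> hi \<Longrightarrow> exactly_one (j = a) (D j) (R (j - 1))"
    and upper: "\<And>j. lo \<le> j \<Longrightarrow> j \<le> hi \<Longrightarrow> exactly_one (v j) (D j) (R j)"
    and ends: "\<not> R (lo - 1)" "\<not> R hi"
  shows "\<exists>b. a \<le> b \<and> b \<le> hi \<and> (\<forall>j\<in>{lo..hi}.
    (v j \<longleftrightarrow> j = b) \<and> (D j \<longleftrightarrow> j < a \<or> b < j) \<and> (R j \<longleftrightarrow> a \<le> j \<and> j < b))"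
proof -
  have before: "j < a \<longrightarrow> D j \<and> \<not> R j" if "lo \<le> j" for j
    using that
  proof (induction j rule: int_ge_induct)
    case base
    then show ?case using lower[of lo] upper[of lo] ends a by (auto simp: exactly_one_def)
  next
    case (step j)
    then show ?case using lower[of "j + 1"] upper[of "j + 1"] a by (auto simp: exactly_one_def)
  qed
  \<comment> \<open>The run of \<open>R\<close> starting at \<open>a\<close> stops, because \<open>R hi\<close> fails.\<close>
  define b where "b = Min {j \<in> {a..hi}. \<not> R j}"
  have fin: "finite {j \<in> {a..hi}. \<not> R j}" by (rule finite_subset[of _ "{a..hi}"]) auto
  have "b \<in> {j \<in> {a..hi}. \<not> R j}"
    unfolding b_def by (rule Min_in[OF fin]) (use a ends in auto)
  then have b: "a \<le> b" "b \<le> hi" "\<not> R b" by auto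
  have between: "R j" if "a \<le> j" "j < b" for j
  proof (rule ccontr)
    assume "\<not> R j"
    then have "b \<le> j" unfolding b_def by (intro Min_le[OF fin]) (use that b in auto)
    then show False using that by simp
  qed
  have at_b: "\<not> D b"
    using lower[of b] between[of "b - 1"] a b by (cases "b = a") (auto simp: exactly_one_def)
  have after: "j \<le> hi \<longrightarrow> \<not> R j \<and> (b < j \<longrightarrow> D j)" if "b \<le> j" for j
    using that
  proof (induction j rule: int_ge_induct)
    case base
    then show ?case using b by simp
  next
    case (step j)
    then show ?case
      using lower[of "j + 1"] upper[of "j + 1"] a b by (auto simp: exactly_one_def)
  qed
  have D: "D j \<longleftrightarrow> j < a \<or> b < j" and R: "R j \<longleftrightarrow> a \<le> j \<and> j < b" if "lo \<le> j" "j \<le> hi" for j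
  proof -
    consider "j < a" | "a \<le> j" "j < b" | "j = b" | "b < j" by linarith
    then have "(D j \<longleftrightarrow> j < a \<or> b < j) \<and> (R j \<longleftrightarrow> a \<le> j \<and> j < b)"
    proof cases
      case 1 then show ?thesis using before that by auto
    next
      case 2 then show ?thesis using between[of j] upper[of j] that by (auto simp: exactly_one_def)
    next
      case 3 then show ?thesis using at_b b by auto
    next
      case 4 then show ?thesis using after[of j] that b by auto
    qed
    then show "D j \<longleftrightarrow> j < a \<or> b < j" "R j \<longleftrightarrow> a \<le> j \<and> j < b" by auto
  qed
  have "v j \<longleftrightarrow> j = b" if "lo \<le> j" "j \<le> hi" for j
    using upper[OF that] D[OF that] R[OF that] b by (auto simp: exactly_one_def)
  with b D R show ?thesis by (intro exI[of _ b]) auto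
qed

definition staircase :: "nat \<Rightarrow> (nat \<Rightarrow> int) \<Rightarrow> (nat \<Rightarrow> int) \<Rightarrow> bool" where
  "staircase m k h \<longleftrightarrow> (\<forall>i. 1 \<le> i \<and> i \<le> m \<longrightarrow> h i \<le> k i) \<and>
     (\<forall>i. 1 \<le> i \<and> i < m \<longrightarrow> h i \<le> h (Suc i) \<and> k i \<le> k (Suc i) \<and> h (Suc i) \<le> k i)"

definition positions :: "nat \<Rightarrow> (nat \<Rightarrow> int) \<Rightarrow> (nat \<Rightarrow> int) \<Rightarrow> (nat \<Rightarrow> int) \<Rightarrow> bool" where
  "positions m k h a \<longleftrightarrow> (\<forall>i. 1 \<le> i \<and> i \<le> m \<longrightarrow> h i - 1 \<le> a i \<and> a i \<le> k i) \<and>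
     (\<forall>i. 1 \<le> i \<and> i < m \<longrightarrow> a i \<le> a (Suc i))"

text \<open>The guards on \<open>i\<close> deal with the two boundary paths: above the first row no vertical edge enters
  the zigzag path and below the last row none leaves it, so that only one of the two conditions
  remains.\<close>

definition path_matching ::
    "nat \<Rightarrow> (nat \<Rightarrow> int) \<Rightarrow> (nat \<Rightarrow> int) \<Rightarrow> (nat \<Rightarrow> int) \<Rightarrow> (real \<times> real) set set" where
  "path_matching m k h a = {e \<in> snd (CHS m k h).
     (\<exists>i j. e = vert i j \<and> j = a i) \<or>
     (\<exists>i j. e = fall i j \<and> (1 \<le> i \<and> j < a i \<or> i < m \<and> a (Suc i) < j)) \<or>
     (\<exists>i j. e = rise i j \<and> (1 \<le> i \<longrightarrow> a i \<le> j) \<and> (i < m \<longrightarrow> j < a (Suc i)))}"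

lemma in_path_matching:
  "vert i j \<in> path_matching m k h a \<longleftrightarrow> vert i j \<in> snd (CHS m k h) \<and> j = a i"
  "fall i j \<in> path_matching m k h a \<longleftrightarrow> fall i j \<in> snd (CHS m k h) \<and>
     (1 \<le> i \<and> j < a i \<or> i < m \<and> a (Suc i) < j)"
  "rise i j \<in> path_matching m k h a \<longleftrightarrow> rise i j \<in> snd (CHS m k h) \<and>
     (1 \<le> i \<longrightarrow> a i \<le> j) \<and> (i < m \<longrightarrow> j < a (Suc i))"
  by (auto simp: path_matching_def)

lemma path_matching_subset: "path_matching m k h a \<subseteq> snd (CHS m k h)"
  by (auto simp: path_matching_def)

text \<open>At the vertex \<open>low i j\<close> the three incident edges correspond to the cases \<open>j = a i\<close>,
  \<open>a i < j \<le> a (i + 1)\<close> and the rest, which are exclusive and exhaustive; the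
  vertices \<open>upp (i + 1) j\<close> are similar.\<close>

lemma perfect_matching_path_matching:
  assumes "staircase m k h" "positions m k h a"
  shows "perfect_matching (CHS m k h) (path_matching m k h a)"
  unfolding perfect_matching_CHS_iff
proof (intro conjI allI impI path_matching_subset)
  fix i j
  have st: "1 \<le> i \<and> i \<le> m \<longrightarrow> h i \<le> k i" "i < m \<longrightarrow> h (Suc i) \<le> k (Suc i)"
    "1 \<le> i \<and> i < m \<longrightarrow> h i \<le> h (Suc i) \<and> k i \<le> k (Suc i) \<and> h (Suc i) \<le> k i"
    using assms(1) by (auto simp: staircase_def)
  have pos: "1 \<le> i \<and> i \<le> m \<longrightarrow> h i - 1 \<le> a i \<and> a i \<le> k i"
    "i < m \<longrightarrow> h (Suc i) - 1 \<le> a (Suc i) \<and> a (Suc i) \<le> k (Suc i)"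
    "1 \<le> i \<and> i < m \<longrightarrow> a i \<le> a (Suc i)"
    using assms(2) by (auto simp: positions_def)
  consider "i = 0" "m = 0" | "i = 0" "0 < m" | "1 \<le> i" "i < m" | "1 \<le> i" "i = m" | "i > m"
    by linarith
  note cases = this
  show "exactly_one (vert i j \<in> path_matching m k h a) (fall i j \<in> path_matching m k h a)
      (rise i (j - 1) \<in> path_matching m k h a)" if "low i j \<in> fst (CHS m k h)"
    using that st pos unfolding in_path_matching low_in_CHS vert_in_CHS fall_in_CHS rise_in_CHS
    by (cases rule: cases; simp add: exactly_one_def; smt (verit))
  show "exactly_one (vert (Suc i) j \<in> path_matching m k h a) (fall i j \<in> path_matching m k h a)
      (rise i j \<in> path_matching m k h a)" if "upp (Suc i) j \<in> fst (CHS m k h)"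
    using that st pos unfolding in_path_matching upp_in_CHS vert_in_CHS fall_in_CHS rise_in_CHS
    by (cases rule: cases; simp add: exactly_one_def; smt (verit))
qed

text \<open>The columns \<open>a i\<close> are found from top to bottom with \<open>zigzag_path\<close>, which turns the unique
  vertical edge entering a zigzag path into a unique one leaving it, in the same column or further
  left, and at the same time determines the edges of the matching on the path.\<close>

lemma perfect_matching_imp_path_matching:
  assumes st: "staircase m k h" and pm: "perfect_matching (CHS m k h) M"
  obtains a where "positions m k h a" "M = path_matching m k h a"
proof (cases "m = 0")
  case True
  then have "snd (CHS m k h) = {}" by (simp add: CHS_rows)
  then have "M = path_matching m k h (\<lambda>_. 0)"
    using pm path_matching_subset[of m k h "\<lambda>_. 0"] unfolding perfect_matching_def by blast
  then show thesis using that[of "\<lambda>_. 0"] True by (simp add: positions_def)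
next
  case False
  \<comment> \<open>Columns of the zigzag path below row \<open>i\<close>. The boundary paths lack one vertex,
    \<open>low 0 (h 1 - 1)\<close> at the top and \<open>upp (m + 1) (k m)\<close> at the bottom. Treating these
    vertices as matched by imaginary vertical edges, recorded in \<open>vv\<close>, makes all paths alike.\<close>
  define lo where "lo i = (if i = 0 then h 1 - 1 else h i - 1)" for i
  define hi where "hi i = (if i = m then k m else k (Suc i))" for i
  define vv where "vv i j \<longleftrightarrow> (if i = 0 then j = h 1 - 1 else if i = Suc m then j = k m
    else vert i j \<in> M)" for i j
  have sub: "M \<subseteq> snd (CHS m k h)"
    and low: "\<And>i j. low i j \<in> fst (CHS m k h) \<Longrightarrow>
        exactly_one (vert i j \<in> M) (fall i j \<in> M) (rise i (j - 1) \<in> M)"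
    and upp: "\<And>i j. upp (Suc i) j \<in> fst (CHS m k h) \<Longrightarrow>
        exactly_one (vert (Suc i) j \<in> M) (fall i j \<in> M) (rise i j \<in> M)"
    using pm unfolding perfect_matching_CHS_iff by blast+
  have level: "\<exists>b. c \<le> b \<and> (\<forall>j. vv (Suc i) j \<longleftrightarrow> j = b) \<and>
      (\<forall>j. lo i \<le> j \<longrightarrow> j \<le> hi i \<longrightarrow> (fall i j \<in> M \<longleftrightarrow> j < c \<or> b < j)) \<and>
      (\<forall>j. lo i \<le> j \<longrightarrow> j \<le> hi i \<longrightarrow> (rise i j \<in> M \<longleftrightarrow> c \<le> j \<and> j < b))"
    if i: "i \<le> m" and c: "\<And>j. vv i j \<longleftrightarrow> j = c" for i c
  proof -
    have st': "1 \<le> i \<longrightarrow> h i \<le> k i" "i < m \<longrightarrow> h (Suc i) \<le> k (Suc i)"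
      "1 \<le> i \<and> i < m \<longrightarrow> h i \<le> h (Suc i) \<and> k i \<le> k (Suc i) \<and> h (Suc i) \<le> k i"
      using st i by (auto simp: staircase_def)
    consider "i = 0" "0 < m" | "1 \<le> i" "i < m" | "1 \<le> i" "i = m"
      using i False by linarith
    note cases = this
    have vertE: "1 \<le> i' \<and> i' \<le> m \<and> h i' - 1 \<le> j \<and> j \<le> k i'" if "vert i' j \<in> M" for i' j
      using subsetD[OF sub that] by (simp add: vert_in_CHS)
    have cM: "1 \<le> i \<Longrightarrow> vert i c \<in> M" using c[of c] i by (auto simp: vv_def)
    have c0: "i = 0 \<Longrightarrow> c = h 1 - 1" using c[of c] by (auto simp: vv_def)
    have crange: "lo i \<le> c" "c \<le> hi i"
      using st' vertE[OF cM] c0 by (cases rule: cases; simp add: lo_def hi_def)+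
    have falls: "fall i j \<in> M \<Longrightarrow> fall i j \<in> snd (CHS m k h)"
      and rises: "rise i j \<in> M \<Longrightarrow> rise i j \<in> snd (CHS m k h)" for j
      using sub by auto
    have lower: "exactly_one (j = c) (fall i j \<in> M) (rise i (j - 1) \<in> M)"
      if j: "lo i \<le> j" "j \<le> hi i" for j
    proof (cases "i = 0 \<and> j = h 1 - 1")
      case True
      then show ?thesis
        using falls[of j] rises[of "j - 1"] c0 by (auto simp: exactly_one_def fall_in_CHS rise_in_CHS)
    next
      case False
      then have "low i j \<in> fst (CHS m k h)"
        using st' j by (cases rule: cases; simp add: low_in_CHS lo_def hi_def; linarith)
      moreover have "vert i j \<in> M \<longleftrightarrow> j = c"
      proof (cases "i = 0")
        case True
        then have "vert i j \<notin> M" using vertE[of i j] by auto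
        then show ?thesis using True False c0 by auto
      qed (use c[of j] i in \<open>auto simp: vv_def\<close>)
      ultimately show ?thesis using low[of i j] by simp
    qed
    have upper: "exactly_one (vv (Suc i) j) (fall i j \<in> M) (rise i j \<in> M)"
      if j: "lo i \<le> j" "j \<le> hi i" for j
    proof (cases "i = m \<and> j = k m")
      case True
      then show ?thesis
        using falls[of j] rises[of j] \<open>m \<noteq> 0\<close>
        by (auto simp: exactly_one_def fall_in_CHS rise_in_CHS vv_def)
    next
      case False
      then have "upp (Suc i) j \<in> fst (CHS m k h)"
        using st' j by (cases rule: cases; simp add: upp_in_CHS lo_def hi_def; linarith)
      moreover have "vert (Suc i) j \<in> M \<longleftrightarrow> vv (Suc i) j"
      proof (cases "i = m")
        case True
        then have "vert (Suc i) j \<notin> M" using vertE[of "Suc i" j] by auto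
        then show ?thesis using True False by (auto simp: vv_def)
      qed (use i in \<open>auto simp: vv_def\<close>)
      ultimately show ?thesis using upp[of i j] by simp
    qed
    have ends: "rise i (lo i - 1) \<notin> M" "rise i (hi i) \<notin> M"
      using rises[of "lo i - 1"] rises[of "hi i"] st'
      by (cases rule: cases; auto simp: rise_in_CHS lo_def hi_def)+
    obtain b where b: "c \<le> b" "b \<le> hi i"
        "\<forall>j\<in>{lo i..hi i}. (vv (Suc i) j \<longleftrightarrow> j = b) \<and>
          (fall i j \<in> M \<longleftrightarrow> j < c \<or> b < j) \<and> (rise i j \<in> M \<longleftrightarrow> c \<le> j \<and> j < b)"
      using zigzag_path[where v = "vv (Suc i)" and D = "\<lambda>j. fall i j \<in> M"
            and R = "\<lambda>j. rise i j \<in> M", OF crange lower upper ends] by blast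
    have inside: "vv (Suc i) j \<Longrightarrow> lo i \<le> j \<and> j \<le> hi i" for j
      using st' vertE[of "Suc i" j]
      by (cases rule: cases; simp add: vv_def lo_def hi_def)
    have "vv (Suc i) j \<longleftrightarrow> j = b" for j
    proof (cases "lo i \<le> j \<and> j \<le> hi i")
      case True
      then show ?thesis using b(3) by simp
    next
      case False
      then show ?thesis using inside[of j] b(1,2) crange by auto
    qed
    then show ?thesis using b by (intro exI[of _ b]) simp
  qed
  have "i \<le> Suc m \<Longrightarrow> \<exists>c. \<forall>j. vv i j \<longleftrightarrow> j = c" for i
  proof (induction i)
    case 0
    then show ?case by (intro exI[of _ "h 1 - 1"]) (simp add: vv_def)
  next
    case (Suc i)
    then obtain c where "\<And>j. vv i j \<longleftrightarrow> j = c" by auto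
    then show ?case using level[of i c] Suc.prems by blast
  qed
  note unique = this
  define a where "a i = (THE j. vv i j)" for i
  have a: "vv i j \<longleftrightarrow> j = a i" if i: "i \<le> Suc m" for i j
  proof -
    obtain c where c: "\<And>j. vv i j \<longleftrightarrow> j = c" using unique[OF i] by blast
    then show ?thesis by (simp add: a_def)
  qed
  have a0: "a 0 = h 1 - 1" and am: "a (Suc m) = k m"
    using a[of 0 "a 0"] a[of "Suc m" "a (Suc m)"] by (auto simp: vv_def)
  have vertM: "vert i j \<in> M \<longleftrightarrow> j = a i" if "1 \<le> i" "i \<le> m" for i j
    using a[of i j] that by (auto simp: vv_def)
  have level_a: "a i \<le> a (Suc i) \<and>
      (\<forall>j. lo i \<le> j \<longrightarrow> j \<le> hi i \<longrightarrow> (fall i j \<in> M \<longleftrightarrow> j < a i \<or> a (Suc i) < j)) \<and>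
      (\<forall>j. lo i \<le> j \<longrightarrow> j \<le> hi i \<longrightarrow> (rise i j \<in> M \<longleftrightarrow> a i \<le> j \<and> j < a (Suc i)))"
    if im: "i \<le> m" for i
  proof -
    obtain b where b: "a i \<le> b" "\<And>j. vv (Suc i) j \<longleftrightarrow> j = b"
        "\<forall>j. lo i \<le> j \<longrightarrow> j \<le> hi i \<longrightarrow> (fall i j \<in> M \<longleftrightarrow> j < a i \<or> b < j)"
        "\<forall>j. lo i \<le> j \<longrightarrow> j \<le> hi i \<longrightarrow> (rise i j \<in> M \<longleftrightarrow> a i \<le> j \<and> j < b)"
      using level[OF im, of "a i"] a[of i] im by auto
    have "b = a (Suc i)" using b(2)[of b] a[of "Suc i" b] im by simp
    with b show ?thesis by simp
  qed
  have pos: "positions m k h a"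
  proof -
    have "h i - 1 \<le> a i \<and> a i \<le> k i" if "1 \<le> i" "i \<le> m" for i
    proof -
      have "vert i (a i) \<in> snd (CHS m k h)" using vertM[OF that] sub by blast
      then show ?thesis by (simp add: vert_in_CHS)
    qed
    then show ?thesis using level_a by (auto simp: positions_def)
  qed
  have range: "lo i \<le> j \<and> j \<le> hi i \<and> i \<le> m"
    if "fall i j \<in> snd (CHS m k h) \<or> rise i j \<in> snd (CHS m k h)" for i j
  proof -
    have "i < m \<longrightarrow> h (Suc i) \<le> k (Suc i)"
      "1 \<le> i \<and> i < m \<longrightarrow> h i \<le> h (Suc i) \<and> k i \<le> k (Suc i) \<and> h (Suc i) \<le> k i"
      using st by (auto simp: staircase_def)
    then show ?thesis
      using that unfolding fall_in_CHS rise_in_CHS lo_def hi_def by (cases "i = 0") auto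
  qed
  have "e \<in> M \<longleftrightarrow> e \<in> path_matching m k h a" if e: "e \<in> snd (CHS m k h)" for e
    using e
  proof (cases rule: CHS_edge_cases)
    case (vert i j)
    then show ?thesis using e vertM[of "Suc i" j] by (auto simp: in_path_matching vert_in_CHS)
  next
    case (fall i j)
    then have r: "lo i \<le> j" "j \<le> hi i" "i \<le> m" using e range by auto
    show ?thesis
      using level_a[OF r(3)] r e fall a0 am
      by (auto simp: in_path_matching lo_def hi_def split: if_splits)
  next
    case (rise i j)
    then have r: "lo i \<le> j" "j \<le> hi i" "i \<le> m" using e range by auto
    then have "0 < m" "i = 0 \<longrightarrow> h 1 - 1 \<le> j" "i = m \<longrightarrow> j < k m"
      using e rise False by (auto simp: lo_def rise_in_CHS)
    then show ?thesis
      using level_a[OF r(3)] r e rise a0 am by (cases "i = 0"; cases "i = m") (auto simp: in_path_matching)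
  qed
  then have "M = path_matching m k h a" using sub path_matching_subset[of m k h a] by blast
  then show thesis using that pos by blast
qed

lemma perfect_matching_CHS_iff_path_matching:
  assumes "staircase m k h"
  shows "perfect_matching (CHS m k h) M \<longleftrightarrow> (\<exists>a. positions m k h a \<and> M = path_matching m k h a)"
  using perfect_matching_path_matching[OF assms] perfect_matching_imp_path_matching[OF assms]
  by metis

section \<open>Truncating the system\<close>

lemma staircase_mono:
  assumes "staircase m k h" "1 \<le> i" "i \<le> j" "j \<le> m"
  shows "h i \<le> h j" "k i \<le> k j"
proof -
  have "j \<le> m \<Longrightarrow> h i \<le> h j \<and> k i \<le> k j"
    using assms(3)
  proof (induction j rule: dec_induct)
    case (step n)
    then have "h n \<le> h (Suc n) \<and> k n \<le> k (Suc n)"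
      using assms(1,2) by (simp add: staircase_def)
    then show ?case using step by auto
  qed simp
  then show "h i \<le> h j" "k i \<le> k j" using assms(4) by auto
qed

lemma positions_mono:
  assumes "positions m k h a" "1 \<le> i" "i \<le> j" "j \<le> m"
  shows "a i \<le> a j"
proof -
  have "j \<le> m \<Longrightarrow> a i \<le> a j"
    using assms(3)
  proof (induction j rule: dec_induct)
    case (step n)
    then have "a n \<le> a (Suc n)"
      using assms(1,2) by (simp add: positions_def)
    then show ?case using step by auto
  qed simp
  then show ?thesis using assms(4) by auto
qed

lemma positions_bounds:
  assumes "positions m k h a" "1 \<le> i" "i \<le> m"
  shows "h i - 1 \<le> a i" "a i \<le> k i"
  using assms by (auto simp: positions_def)

lemma vert_in_path_matching:
  assumes "staircase m k h" "positions m k h a" "1 \<le> i" "i \<le> m"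
  shows "vert i j \<in> path_matching m k h a \<longleftrightarrow> j = a i"
  using assms positions_bounds[OF assms(2-4)]
  by (auto simp: in_path_matching vert_in_CHS staircase_def)

lemma path_matching_cong:
  assumes "\<And>i. 1 \<le> i \<Longrightarrow> i \<le> m \<Longrightarrow> a i = b i"
  shows "path_matching m k h a = path_matching m k h b"
proof -
  have "e \<in> path_matching m k h a \<longleftrightarrow> e \<in> path_matching m k h b" if e: "e \<in> snd (CHS m k h)" for e
    using e
  proof (cases rule: CHS_edge_cases)
    case (vert i j)
    then show ?thesis using e assms[of "Suc i"] by (auto simp: in_path_matching vert_in_CHS)
  next
    case (fall i j)
    then have "i \<le> m" using e by (auto simp: fall_in_CHS)
    then show ?thesis using fall assms[of i] assms[of "Suc i"] by (auto simp: in_path_matching)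
  next
    case (rise i j)
    then have "i \<le> m" using e by (auto simp: rise_in_CHS)
    then show ?thesis using rise assms[of i] assms[of "Suc i"] by (auto simp: in_path_matching)
  qed
  then show ?thesis using path_matching_subset by blast
qed

lemma staircase_truncate:
  assumes "staircase m k h" "q \<le> m" "\<And>s. 1 \<le> s \<Longrightarrow> s \<le> q \<Longrightarrow> h s \<le> c"
  shows "staircase q (\<lambda>s. min (k s) c) h"
  using assms unfolding staircase_def by (auto simp: min_le_iff_disj)

lemma truncate_subset:
  assumes "q \<le> m"
  shows "snd (CHS q (\<lambda>s. min (k s) c) h) \<subseteq> snd (CHS m k h)"
  using assms unfolding CHS_rows by fastforce

text \<open>The condition on \<open>a (Suc q)\<close> makes the path pass row \<open>q + 1\<close> no further right than column \<open>c\<close>, the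
  left end of the truncated system, so that its lowest zigzag path does not notice the rows that were cut off.\<close>

lemma path_matching_truncate:
  assumes q: "q \<le> m" and c: "q < m \<Longrightarrow> c \<le> a (Suc q)"
  shows "path_matching m k h a \<inter> snd (CHS q (\<lambda>s. min (k s) c) h)
           = path_matching q (\<lambda>s. min (k s) c) h a"
    (is "_ \<inter> snd ?G' = ?M'")
proof -
  have "e \<in> path_matching m k h a \<longleftrightarrow> e \<in> ?M'" if e: "e \<in> snd ?G'" for e
  proof -
    have e': "e \<in> snd (CHS m k h)" using truncate_subset[OF q] e by blast
    from e show ?thesis
    proof (cases rule: CHS_edge_cases)
      case (vert i j)
      then show ?thesis using e e' by (simp add: in_path_matching)
    next
      case (fall i j)
      then have "i \<le> q" "i = q \<longrightarrow> j < c" using e by (auto simp: fall_in_CHS)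
      then show ?thesis using fall e e' q c by (cases "i = q") (auto simp: in_path_matching)
    next
      case (rise i j)
      then have "i \<le> q" "i = q \<longrightarrow> j < c" using e by (auto simp: rise_in_CHS)
      then show ?thesis using rise e e' q c by (cases "i = q") (auto simp: in_path_matching)
    qed
  qed
  then show ?thesis using path_matching_subset by blast
qed

text \<open>An edge of the first \<open>q\<close> rows that the truncation removes lies to the left of every path in the
  truncated system, and such an edge is in the matching exactly if it is a \<open>fall\<close>. The remaining
  edges depend only on the positions below row \<open>q\<close>, except on the zigzag path below row \<open>q\<close>, whose
  removed part does not extend to the right of position \<open>a q\<close>.\<close>

lemma path_matching_outside_truncation:
  assumes st: "staircase m k h" and q: "q \<le> m" and c: "\<And>s. 1 \<le> s \<Longrightarrow> s \<le> q \<Longrightarrow> h s \<le> c"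
    and a: "positions q (\<lambda>s. min (k s) c) h a" and b: "positions q (\<lambda>s. min (k s) c) h b"
    and tail: "\<And>s. q < s \<Longrightarrow> s \<le> m \<Longrightarrow> a s = b s"
    and e: "e \<in> path_matching m k h a" "e \<notin> snd (CHS q (\<lambda>s. min (k s) c) h)"
  shows "e \<in> path_matching m k h b"
proof -
  let ?k = "\<lambda>s. min (k s) c"
  have e': "e \<in> snd (CHS m k h)" using e path_matching_subset by blast
  have rows: "h s - 1 \<le> a s" "a s \<le> ?k s" "h s - 1 \<le> b s" "b s \<le> ?k s" "h s \<le> ?k s" "h s \<le> k s"
    if "1 \<le> s" "s \<le> q" for s
    using positions_bounds[OF a that] positions_bounds[OF b that] c[OF that] st q that
    by (auto simp: staircase_def)
  have conn: "h s \<le> h (Suc s)" "h (Suc s) \<le> ?k s" if "1 \<le> s" "s < q" for s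
    using st q that c[of "Suc s"] by (auto simp: staircase_def)
  from e' show ?thesis
  proof (cases rule: CHS_edge_cases)
    case (vert i j)
    then have "\<not> Suc i \<le> q" "j = a (Suc i)" "Suc i \<le> m"
      using e rows[of "Suc i"] by (auto simp: in_path_matching vert_in_CHS)
    then show ?thesis using e' vert tail[of "Suc i"] by (auto simp: in_path_matching)
  next
    case (fall i j)
    have m: "1 \<le> i \<and> j < a i \<or> i < m \<and> a (Suc i) < j"
      and E: "(1 \<le> i \<and> i \<le> m \<and> h i - 1 \<le> j \<and> j < k i) \<or> (i < m \<and> h (Suc i) \<le> j \<and> j \<le> k (Suc i))"
      and E': "\<not> (1 \<le> i \<and> i \<le> q \<and> h i - 1 \<le> j \<and> j < ?k i)"
        "\<not> (i < q \<and> h (Suc i) \<le> j \<and> j \<le> ?k (Suc i))"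
      using e e' unfolding fall in_path_matching fall_in_CHS by blast+
    have "1 \<le> i \<and> j < b i \<or> i < m \<and> b (Suc i) < j"
    proof -
      consider "i < q" | "i = q" | "q < i" "i \<le> m" using E by linarith
      then show ?thesis
      proof cases
        case 1
        show ?thesis
        proof (cases "h (Suc i) \<le> j")
          case True
          then have "?k (Suc i) < j" using E'(2) 1 by auto
          then show ?thesis using rows(4)[of "Suc i"] 1 q by auto
        next
          case False
          then show ?thesis using E E'(1) conn(2)[of i] 1 by auto
        qed
      next
        case 2
        have "h i \<le> h (Suc i)" if "1 \<le> i" "i < m" using st that by (simp add: staircase_def)
        then show ?thesis using m E E' rows(2,4)[of i] tail[of "Suc i"] 2 by (cases "1 \<le> i") auto
      next
        case 3
        then show ?thesis using m tail[of i] tail[of "Suc i"] by auto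
      qed
    qed
    then show ?thesis using fall e' by (simp add: in_path_matching)
  next
    case (rise i j)
    have m: "1 \<le> i \<longrightarrow> a i \<le> j" "i < m \<longrightarrow> j < a (Suc i)"
      and E: "(1 \<le> i \<and> i \<le> m \<and> h i - 1 \<le> j \<and> j < k i) \<or>
        (i < m \<and> h (Suc i) - 1 \<le> j \<and> j < k (Suc i))"
      and E': "\<not> (1 \<le> i \<and> i \<le> q \<and> h i - 1 \<le> j \<and> j < ?k i)"
        "\<not> (i < q \<and> h (Suc i) - 1 \<le> j \<and> j < ?k (Suc i))"
      using e e' unfolding rise in_path_matching rise_in_CHS by blast+
    have "(1 \<le> i \<longrightarrow> b i \<le> j) \<and> (i < m \<longrightarrow> j < b (Suc i))"
    proof -
      consider "i < q" | "i = q" | "q < i" "i \<le> m" using E by linarith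
      then show ?thesis
      proof cases
        case 1
        have "j < ?k (Suc i)" using m(2) rows(2)[of "Suc i"] 1 q by auto
        then have "j < h (Suc i) - 1" using E'(2) 1 by auto
        then have "1 \<le> i" "j < ?k i" using E conn(2)[of i] 1 by auto
        then have False using E'(1) m(1) rows(1)[of i] 1 by auto
        then show ?thesis ..
      next
        case 2
        then show ?thesis using m E E' rows(1,4)[of i] tail[of "Suc i"] 2 by (cases "1 \<le> i") auto
      next
        case 3
        then show ?thesis using m tail[of i] tail[of "Suc i"] by auto
      qed
    qed
    then show ?thesis using rise e' by (simp add: in_path_matching)
  qed
qed

lemma CHS_drop_empty_rows:
  assumes "q' \<le> q" "\<And>s. q' < s \<Longrightarrow> s \<le> q \<Longrightarrow> k s < h s"
  shows "CHS q k h = CHS q' k h"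
  using assms
proof (induction q rule: dec_induct)
  case (step n)
  have "{h (Suc n)..k (Suc n)} = {}" using step by simp
  then have "CHS (Suc n) k h = CHS n k h"
    by (intro prod_eqI) (simp_all only: CHS_rows lessThan_Suc UN_insert image_empty Union_empty Un_empty_left)
  then show ?case using step by simp
qed simp

text \<open>Truncating at column \<open>c\<close> empties the rows with \<open>h s > c\<close>. Since \<open>h\<close> is monotone these are the
  last ones, so that a truncated system is a system with fewer, nonempty rows.\<close>

lemma nonempty_rows_prefix:
  fixes h :: "nat \<Rightarrow> int"
  assumes "\<And>i j. 1 \<le> i \<Longrightarrow> i \<le> j \<Longrightarrow> j \<le> q \<Longrightarrow> h i \<le> h j"
  shows "\<exists>q'\<le>q. (\<forall>s. 1 \<le> s \<and> s \<le> q' \<longrightarrow> h s \<le> c) \<and> (\<forall>s. q' < s \<and> s \<le> q \<longrightarrow> c < h s)"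
proof -
  let ?P = "\<lambda>s. s \<le> q \<and> (s = 0 \<or> h s \<le> c)"
  define q' where "q' = (GREATEST s. ?P s)"
  have q': "?P q'" unfolding q'_def by (rule GreatestI_nat[of ?P 0 q]) auto
  have max: "s \<le> q'" if "?P s" for s
    unfolding q'_def by (rule Greatest_le_nat[of ?P s q]) (use that in auto)
  have "h s \<le> c" if "1 \<le> s" "s \<le> q'" for s
    using assms[of s q'] q' that by auto
  moreover have "c < h s" if "q' < s" "s \<le> q" for s
    using max[of s] that by (cases "h s \<le> c") auto
  ultimately show ?thesis using q' by blast
qed

text \<open>The edge \<open>e\<close> is assumed to single out the paths that stay within column \<open>c\<close> in the first \<open>q\<close> rows
  and continue vertically in column \<open>t\<close>; the assumption \<open>flip\<close> provides the rotation of an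
  alternating hexagon below row \<open>q\<close>. In rows that become empty by the truncation the
  path is confined to column \<open>c\<close>, so they may be counted among the fixed ones.\<close>

lemma sum_matchings_with_fixed_tail:
  assumes st: "staircase m k h" and q: "q < m"
    and hc: "\<And>s. 1 \<le> s \<Longrightarrow> s \<le> q \<Longrightarrow> h s - 1 \<le> c"
    and ct: "c \<le> t" and ht: "\<And>s. q < s \<Longrightarrow> s \<le> m \<Longrightarrow> h s - 1 \<le> t \<and> t \<le> k s"
    and e: "\<And>a. positions m k h a \<Longrightarrow> e \<in> path_matching m k h a \<longleftrightarrow>
        (\<forall>s. 1 \<le> s \<and> s \<le> q \<longrightarrow> a s \<le> c) \<and> (\<forall>s. q < s \<and> s \<le> m \<longrightarrow> a s = t)"
    and flip: "\<And>a. \<lbrakk>positions m k h a; e \<in> path_matching m k h a\<rbrakk> \<Longrightarrow>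
        \<exists>b. positions m k h b \<and> (\<forall>s\<le>q. b s = a s) \<and> c \<le> b (Suc q) \<and>
            (\<exists>s. q < s \<and> s \<le> m \<and> b s \<noteq> t)"
  shows "(\<Sum>M | perfect_matching (CHS m k h) M \<and> e \<in> M. monom 1 (forcing_number (CHS m k h) M))
           = CHS_poly q (\<lambda>s. min (k s) c) h * [:0, 1:]"
proof -
  have "h i \<le> h j" if "1 \<le> i" "i \<le> j" "j \<le> q" for i j
    by (rule staircase_mono(1)[OF st that(1,2)]) (use that q in simp)
  then obtain q' where q': "q' \<le> q" "\<And>s. 1 \<le> s \<Longrightarrow> s \<le> q' \<Longrightarrow> h s \<le> c"
      and empty: "\<And>s. q' < s \<Longrightarrow> s \<le> q \<Longrightarrow> c < h s"
    using nonempty_rows_prefix[of q h c] by blast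
  define k' where "k' = (\<lambda>s. min (k s) c)"
  have G': "CHS q k' h = CHS q' k' h"
    by (rule CHS_drop_empty_rows[OF q'(1)]) (use empty in \<open>auto simp: k'_def min_less_iff_disj\<close>)
  have q'm: "q' \<le> m" using q' q by simp
  have st': "staircase q' k' h"
    unfolding k'_def by (rule staircase_truncate[OF st q'm q'(2)])
  note PM = perfect_matching_CHS_iff_path_matching[OF st]
  note PM' = perfect_matching_CHS_iff_path_matching[OF st']
  have at_empty: "h s = c + 1" if "q' < s" "s \<le> q" for s
    using empty[OF that] hc[of s] that by simp
  have class_pos: "positions q' k' h a"
    and class_tail: "\<And>s. q' < s \<Longrightarrow> s \<le> m \<Longrightarrow> a s = (if s \<le> q then c else t)"
    if a: "positions m k h a" "e \<in> path_matching m k h a" for a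
  proof -
    have *: "\<And>s. 1 \<le> s \<Longrightarrow> s \<le> q \<Longrightarrow> a s \<le> c" "\<And>s. q < s \<Longrightarrow> s \<le> m \<Longrightarrow> a s = t"
      using e[OF a(1)] a(2) by auto
    show "positions q' k' h a"
      using a(1) * q' q'm by (auto simp: positions_def k'_def)
    show "a s = (if s \<le> q then c else t)" if "q' < s" "s \<le> m" for s
      using *[of s] at_empty[of s] positions_bounds(1)[OF a(1), of s] that by (cases "s \<le> q") auto
  qed
  have class_next: "q' < m \<Longrightarrow> c \<le> a (Suc q')"
    if "positions m k h a" "e \<in> path_matching m k h a" for a
    using class_tail[OF that, of "Suc q'"] ct by auto
  have truncate: "path_matching m k h a \<inter> snd (CHS q' k' h) = path_matching q' k' h a"
    if "q' < m \<Longrightarrow> c \<le> a (Suc q')" for a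
    unfolding k'_def by (rule path_matching_truncate[OF q'm], rule that)
  have "(\<Sum>M | perfect_matching (CHS m k h) M \<and> e \<in> M. monom 1 (forcing_number (CHS m k h) M))
      = forcing_polynomial (CHS q' k' h) * [:0, 1:]"
  proof (rule sum_matchings_containing_edge)
    show "finite (snd (CHS m k h))" "{} \<notin> snd (CHS m k h)"
      by (rule finite_CHS empty_notin_CHS)+
    show "snd (CHS q' k' h) \<subseteq> snd (CHS m k h)"
      unfolding k'_def by (rule truncate_subset[OF q'm])
  next
    fix M assume M: "perfect_matching (CHS m k h) M" "e \<in> M"
    then obtain a where a: "positions m k h a" "M = path_matching m k h a" using PM by blast
    then have ea: "e \<in> path_matching m k h a" using M by simp
    have trunc: "M \<inter> snd (CHS q' k' h) = path_matching q' k' h a"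
      using truncate[of a] class_next[OF a(1) ea] a(2) by blast
    show "perfect_matching (CHS q' k' h) (M \<inter> snd (CHS q' k' h))"
      unfolding trunc PM' using class_pos[OF a(1) ea] by blast
    obtain b where b: "positions m k h b" "\<forall>s\<le>q. b s = a s" "c \<le> b (Suc q)"
        "\<exists>s. q < s \<and> s \<le> m \<and> b s \<noteq> t"
      using flip[OF a(1) ea] by blast
    then obtain s where s: "q < s" "s \<le> m" "b s \<noteq> t" by blast
    have "c \<le> b (Suc q')"
      using b class_next[OF a(1) ea] q' q by (cases "q' = q") auto
    then have "path_matching m k h b \<inter> snd (CHS q' k' h) = path_matching q' k' h b"
      by (rule truncate)
    also have "\<dots> = path_matching q' k' h a"
      by (rule path_matching_cong) (use b q' in auto)
    finally have "M \<inter> snd (CHS q' k' h) \<subseteq> path_matching m k h b" unfolding trunc by blast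
    moreover have "path_matching m k h b \<noteq> M"
    proof -
      have "a s = t" using class_tail[OF a(1) ea, of s] s q' by auto
      then have "vert s t \<in> M" "vert s t \<notin> path_matching m k h b"
        using s vert_in_path_matching[OF st a(1), of s t] vert_in_path_matching[OF st b(1), of s t] a(2)
        by auto
      then show ?thesis by blast
    qed
    ultimately show "\<exists>N. perfect_matching (CHS m k h) N \<and> N \<noteq> M \<and> M \<inter> snd (CHS q' k' h) \<subseteq> N"
      using perfect_matching_path_matching[OF st b(1)] by blast
  next
    fix M N
    assume M: "perfect_matching (CHS m k h) M" "e \<in> M"
      and N: "perfect_matching (CHS m k h) N" "e \<in> N"
    have sub: "path_matching m k h a - snd (CHS q' k' h) \<subseteq> path_matching m k h b"
      if a: "positions m k h a" "e \<in> path_matching m k h a"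
        and b: "positions m k h b" "e \<in> path_matching m k h b" for a b
    proof
      fix x assume x: "x \<in> path_matching m k h a - snd (CHS q' k' h)"
      show "x \<in> path_matching m k h b"
      proof (rule path_matching_outside_truncation[OF st q'm])
        show "positions q' (\<lambda>s. min (k s) c) h a"
          using class_pos[OF a] by (simp only: k'_def)
        show "positions q' (\<lambda>s. min (k s) c) h b"
          using class_pos[OF b] by (simp only: k'_def)
        show "a s = b s" if "q' < s" "s \<le> m" for s
          by (rule trans[OF class_tail[OF a that] class_tail[OF b that, symmetric]])
        show "x \<notin> snd (CHS q' (\<lambda>s. min (k s) c) h)"
          using x by (simp add: k'_def)
      qed (use x q'(2) in blast)+
    qed
    obtain a where a: "positions m k h a" "M = path_matching m k h a"
      using M(1) PM by blast
    obtain b where b: "positions m k h b" "N = path_matching m k h b"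
      using N(1) PM by blast
    have "e \<in> path_matching m k h a" "e \<in> path_matching m k h b" using M(2) N(2) a(2) b(2) by auto
    then have "M - snd (CHS q' k' h) \<subseteq> N" "N - snd (CHS q' k' h) \<subseteq> M"
      unfolding a(2) b(2) using sub[OF a(1) _ b(1)] sub[OF b(1) _ a(1)] by blast+
    then show "M - snd (CHS q' k' h) = N - snd (CHS q' k' h)" by blast
  next
    fix M' assume "perfect_matching (CHS q' k' h) M'"
    then obtain a' where a': "positions q' k' h a'" "M' = path_matching q' k' h a'"
      using PM' by blast
    define a where "a s = (if s \<le> q' then a' s else if s \<le> q then c else t)" for s
    have row: "h s - 1 \<le> a' s" "a' s \<le> c" "a' s \<le> k s" if "1 \<le> s" "s \<le> q'" for s
      using positions_bounds[OF a'(1) that] by (auto simp: k'_def)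
    have ck: "c \<le> k s" if "q' < s" "s \<le> q" for s
    proof -
      have "h s \<le> k s" using st q that by (simp add: staircase_def)
      then show ?thesis using at_empty[OF that] by simp
    qed
    have a: "positions m k h a"
      unfolding positions_def
    proof (intro conjI allI impI; elim conjE)
      fix s assume s: "1 \<le> s" "s \<le> m"
      show "h s - 1 \<le> a s" "a s \<le> k s"
        using row[of s] hc[of s] ck[of s] ht[of s] s by (auto simp: a_def)
    next
      fix s assume s: "1 \<le> s" "s < m"
      show "a s \<le> a (Suc s)"
        using a'(1) row[of s] s ct q'(1) by (auto simp: a_def positions_def)
    qed
    have ea: "e \<in> path_matching m k h a"
      unfolding e[OF a] using row q'(1) by (auto simp: a_def)
    have "path_matching m k h a \<inter> snd (CHS q' k' h) = path_matching q' k' h a"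
      using truncate[of a] class_next[OF a ea] by blast
    also have "\<dots> = M'"
      unfolding a'(2) by (rule path_matching_cong) (simp add: a_def)
    finally show "\<exists>M. perfect_matching (CHS m k h) M \<and> e \<in> M \<and> M \<inter> snd (CHS q' k' h) = M'"
      using perfect_matching_path_matching[OF st a] ea by blast
  qed
  then show ?thesis using G' by (simp only: CHS_poly_def k'_def)
qed

section \<open>The recurrence\<close>

lemma sum_by_unique_member:
  fixes g :: "'a set \<Rightarrow> 'b::comm_monoid_add"
  assumes "finite X" "finite {M. P M}" "\<And>M. P M \<Longrightarrow> \<exists>!e. e \<in> X \<and> e \<in> M"
  shows "(\<Sum>M | P M. g M) = (\<Sum>e\<in>X. \<Sum>M | P M \<and> e \<in> M. g M)"
proof -
  have "(\<Sum>e\<in>X. \<Sum>M | P M \<and> e \<in> M. g M) = (\<Sum>e\<in>X. \<Sum>M | M \<in> {M. P M} \<and> e \<in> M. g M)"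
    by simp
  also have "\<dots> = (\<Sum>M | P M. \<Sum>e | e \<in> X \<and> e \<in> M. g M)"
    by (rule sum.swap_restrict[OF assms(1,2)])
  also have "\<dots> = (\<Sum>M | P M. g M)"
  proof (rule sum.cong[OF refl])
    fix M assume "M \<in> {M. P M}"
    then obtain e where e: "e \<in> X \<and> e \<in> M" "\<And>e'. e' \<in> X \<and> e' \<in> M \<Longrightarrow> e' = e"
      using assms(3)[of M] by blast
    then have "{e. e \<in> X \<and> e \<in> M} = {e}" by blast
    then show "(\<Sum>e | e \<in> X \<and> e \<in> M. g M) = g M" by simp
  qed
  finally show ?thesis ..
qed

theorem theorem3p2:
  fixes m p :: nat and k h :: "nat \<Rightarrow> int"
  assumes "m \<ge> 1"
    and "\<And>i. 1 \<le> i \<Longrightarrow> i < m \<Longrightarrow> k (i + 1) \<ge> k i"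
    and "\<And>i. 1 \<le> i \<Longrightarrow> i < m \<Longrightarrow> h (i + 1) \<ge> h i"
    and "\<And>j. 1 \<le> j \<Longrightarrow> j \<le> m \<Longrightarrow> k j \<ge> h j"
    and "h 1 = 1"
    and "\<And>i. 1 \<le> i \<Longrightarrow> i < m \<Longrightarrow> h (i + 1) \<le> k i"
    and "p = Min {s \<in> {1..m}. k s = k m}"
  shows "CHS_poly m k h =
      (\<Sum>i = h m - 1..k m - 1. CHS_poly (m - 1) (\<lambda>s. min (k s) i) h * [:0, 1:])
    + (\<Sum>j = p..m. CHS_poly (j - 1) (\<lambda>s. min (k s) (k m - 1)) h * [:0, 1:])"
proof -
  define K where "K = k m"
  let ?G = "CHS m k h"
  let ?rise = "\<lambda>j. rise (j - 1) (K - 1)"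
  have st: "staircase m k h"
    using assms(2,3,4,6) by (auto simp: staircase_def)
  have p: "p \<in> {s \<in> {1..m}. k s = k m}"
    unfolding assms(7) by (rule Min_in) (use assms(1) in auto)
  have p_le: "p \<le> s" if "1 \<le> s" "s \<le> m" "k s = K" for s
    unfolding assms(7) by (rule Min_le) (use that in \<open>auto simp: K_def\<close>)
  have p1: "1 \<le> p" "p \<le> m" using p by auto
  have le_K: "k s \<le> K" if "1 \<le> s" "s \<le> m" for s
    using staircase_mono(2)[OF st that(1,2)] by (simp add: K_def)
  have kK: "k s = K" if "p \<le> s" "s \<le> m" for s
    using staircase_mono(2)[OF st p1(1) that] le_K[of s] p that by (auto simp: K_def)
  have hk: "h s \<le> k s" if "1 \<le> s" "s \<le> m" for s
    using assms(4) that by simp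
  have hm: "h s \<le> h m" if "1 \<le> s" "s \<le> m" for s
    using staircase_mono(1)[OF st that(1,2)] by simp
  have rise_iff: "?rise j \<in> path_matching m k h a \<longleftrightarrow> (2 \<le> j \<longrightarrow> a (j - 1) < K) \<and> a j = K"
    if a: "positions m k h a" and j: "p \<le> j" "j \<le> m" for a j
  proof -
    have j1: "1 \<le> j" "Suc (j - 1) = j" "j - 1 < m" using j p1 by auto
    have "?rise j \<in> snd ?G"
      using j1 kK[OF j] hk[OF j1(1) j(2)] by (auto simp: rise_in_CHS)
    moreover have "a j \<le> K" using positions_bounds(2)[OF a j1(1) j(2)] kK[OF j] by simp
    ultimately show ?thesis using j1 by (auto simp: in_path_matching)
  qed
  \<comment> \<open>Paths ending in column \<open>i < K\<close>: moving the last position to \<open>i + 1\<close> rotates a hexagon.\<close>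
  have vert_sum: "(\<Sum>M | perfect_matching ?G M \<and> vert m i \<in> M. monom 1 (forcing_number ?G M))
      = CHS_poly (m - 1) (\<lambda>s. min (k s) i) h * [:0, 1:]"
    if i: "i \<in> {h m - 1..K - 1}" for i
  proof (rule sum_matchings_with_fixed_tail[OF st, where t = i])
    show "m - 1 < m" using assms(1) by simp
    show "h s - 1 \<le> i" if "1 \<le> s" "s \<le> m - 1" for s
    proof -
      have "s \<le> m" using that by linarith
      then show ?thesis using hm[of s] that i by simp
    qed
    show "h s - 1 \<le> i \<and> i \<le> k s" if "m - 1 < s" "s \<le> m" for s
    proof -
      have "s = m" using that by simp
      then show ?thesis using i by (simp add: K_def)
    qed
    fix a assume a: "positions m k h a"
    have last: "m - 1 < s \<and> s \<le> m \<longleftrightarrow> s = m" for s using assms(1) by auto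
    show iff: "vert m i \<in> path_matching m k h a \<longleftrightarrow>
      (\<forall>s. 1 \<le> s \<and> s \<le> m - 1 \<longrightarrow> a s \<le> i) \<and> (\<forall>s. m - 1 < s \<and> s \<le> m \<longrightarrow> a s = i)"
      unfolding last vert_in_path_matching[OF st a assms(1) order_refl]
      using positions_mono[OF a, of _ m] by fastforce
    assume "vert m i \<in> path_matching m k h a"
    then have am: "a m = i" by (simp add: vert_in_path_matching[OF st a assms(1)])
    have "positions m k h (a(m := i + 1))"
      using a i am positions_mono[OF a, of _ m] by (fastforce simp: positions_def K_def)
    then show "\<exists>b. positions m k h b \<and> (\<forall>s\<le>m - 1. b s = a s) \<and> i \<le> b (Suc (m - 1)) \<and>
        (\<exists>s. m - 1 < s \<and> s \<le> m \<and> b s \<noteq> i)"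
      using assms(1) by (intro exI[of _ "a(m := i + 1)"]) auto
  qed simp
  \<comment> \<open>Paths that reach column \<open>K\<close> first in row \<open>j\<close>: moving position \<open>j\<close> back to \<open>K - 1\<close> rotates a
    hexagon. For \<open>j > p\<close> the vertical edge of row \<open>j\<close> would not do in place of the rising
    one, as it leaves \<open>a (j - 1) = K\<close> possible.\<close>
  have rise_sum: "(\<Sum>M | perfect_matching ?G M \<and> ?rise j \<in> M. monom 1 (forcing_number ?G M))
      = CHS_poly (j - 1) (\<lambda>s. min (k s) (K - 1)) h * [:0, 1:]"
    if j: "j \<in> {p..m}" for j
  proof (rule sum_matchings_with_fixed_tail[OF st, where t = K])
    have j1: "1 \<le> j" "p \<le> j" "j \<le> m" "Suc (j - 1) = j" using j p1 by auto
    show "j - 1 < m" using j1 by simp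
    show "h s - 1 \<le> K - 1" if "1 \<le> s" "s \<le> j - 1" for s
    proof -
      have "s \<le> m" using that j1 by linarith
      then show ?thesis using hk[of s] le_K[of s] that by simp
    qed
    show "h s - 1 \<le> K \<and> K \<le> k s" if "j - 1 < s" "s \<le> m" for s
    proof -
      have "p \<le> s" "1 \<le> s" using that j1 by linarith+
      then show ?thesis using kK[of s] hk[of s] that by simp
    qed
    fix a assume a: "positions m k h a"
    have top: "a s \<le> K" if "1 \<le> s" "s \<le> m" for s
      using positions_bounds(2)[OF a that] le_K[OF that] by simp
    show iff: "?rise j \<in> path_matching m k h a \<longleftrightarrow>
      (\<forall>s. 1 \<le> s \<and> s \<le> j - 1 \<longrightarrow> a s \<le> K - 1) \<and> (\<forall>s. j - 1 < s \<and> s \<le> m \<longrightarrow> a s = K)"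
      unfolding rise_iff[OF a j1(2,3)]
    proof (intro iffI conjI allI impI; elim conjE)
      fix s assume *: "2 \<le> j \<longrightarrow> a (j - 1) < K" "1 \<le> s" "s \<le> j - 1"
      then show "a s \<le> K - 1" using positions_mono[OF a, of s "j - 1"] j1 by fastforce
    next
      fix s assume *: "a j = K" "j - 1 < s" "s \<le> m"
      then show "a s = K" using positions_mono[OF a, of j s] top[of s] j1 by fastforce
    next
      assume "\<forall>s. 1 \<le> s \<and> s \<le> j - 1 \<longrightarrow> a s \<le> K - 1" "2 \<le> j"
      then show "a (j - 1) < K" by fastforce
    next
      assume "\<forall>s. j - 1 < s \<and> s \<le> m \<longrightarrow> a s = K"
      then show "a j = K" using j1 by simp
    qed
    assume "?rise j \<in> path_matching m k h a"
    then have aj: "2 \<le> j \<longrightarrow> a (j - 1) < K" "a j = K" using rise_iff[OF a j1(2,3)] by auto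
    have "positions m k h (a(j := K - 1))"
      unfolding positions_def
    proof (intro conjI allI impI; elim conjE)
      fix s assume s: "1 \<le> s" "s \<le> m"
      show "h s - 1 \<le> (a(j := K - 1)) s" "(a(j := K - 1)) s \<le> k s"
        using positions_bounds[OF a s] hk[OF s] kK[of j] j1 by auto
    next
      fix s assume s: "1 \<le> s" "s < m"
      then have "a s \<le> a (Suc s)" using a by (simp add: positions_def)
      then show "(a(j := K - 1)) s \<le> (a(j := K - 1)) (Suc s)"
        using aj s by auto
    qed
    then show "\<exists>b. positions m k h b \<and> (\<forall>s\<le>j - 1. b s = a s) \<and> K - 1 \<le> b (Suc (j - 1)) \<and>
        (\<exists>s. j - 1 < s \<and> s \<le> m \<and> b s \<noteq> K)"
      using j1 by (intro exI[of _ "a(j := K - 1)"]) auto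
  qed simp
  define A where "A = vert m ` {h m - 1..K - 1}"
  define B where "B = ?rise ` {p..m}"
  have fin: "finite {M. perfect_matching ?G M}"
    by (rule finite_subset[of _ "Pow (snd ?G)"]) (auto simp: perfect_matching_def finite_CHS)
  have unique: "\<exists>!e. e \<in> A \<union> B \<and> e \<in> M" if "perfect_matching ?G M" for M
  proof -
    obtain a where a: "positions m k h a" and M: "M = path_matching m k h a"
      using \<open>perfect_matching ?G M\<close> perfect_matching_CHS_iff_path_matching[OF st] by blast
    have inA: "vert m i \<in> M \<longleftrightarrow> i = a m" for i
      unfolding M by (rule vert_in_path_matching[OF st a assms(1) order_refl])
    have inB: "?rise j \<in> M \<longleftrightarrow> (2 \<le> j \<longrightarrow> a (j - 1) < K) \<and> a j = K" if "j \<in> {p..m}" for j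
      unfolding M using rise_iff[OF a] that by auto
    have am: "h m - 1 \<le> a m" "a m \<le> K"
      using positions_bounds[OF a assms(1) order_refl] by (auto simp: K_def)
    show ?thesis
    proof (cases "a m = K")
      case False
      have "?rise j \<notin> M" if "j \<in> {p..m}" for j
        using inB[OF that] positions_mono[OF a, of j m] that p1 False am by auto
      then show ?thesis
        using inA False am by (intro ex1I[of _ "vert m (a m)"]) (auto simp: A_def B_def)
    next
      case True
      define j where "j = (LEAST s. 1 \<le> s \<and> a s = K)"
      have j: "1 \<le> j" "a j = K"
        using LeastI[of "\<lambda>s. 1 \<le> s \<and> a s = K" m] True assms(1) by (auto simp: j_def)
      have before: "j \<le> s" if "1 \<le> s" "a s = K" for s
        unfolding j_def by (rule Least_le) (use that in simp)
      have "j \<le> m" using before assms(1) True by simp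
      have "k j = K"
        using positions_bounds(2)[OF a j(1) \<open>j \<le> m\<close>] le_K[OF j(1) \<open>j \<le> m\<close>] j by simp
      then have jp: "j \<in> {p..m}" using p_le j \<open>j \<le> m\<close> by simp
      have le: "a s \<le> K" if "1 \<le> s" "s \<le> m" for s
        using positions_mono[OF a that(1,2)] True by simp
      have "?rise j' \<in> M \<longleftrightarrow> j' = j" if j': "j' \<in> {p..m}" for j'
      proof
        assume "?rise j' \<in> M"
        then have *: "2 \<le> j' \<longrightarrow> a (j' - 1) < K" "a j' = K" using inB[OF j'] by auto
        then have "j \<le> j'" using before j' p1 by simp
        moreover have False if "j < j'"
        proof -
          have "j \<le> j' - 1" "j' - 1 \<le> m" "2 \<le> j'" using that j j' by auto
          then show ?thesis using positions_mono[OF a j(1), of "j' - 1"] * j by simp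
        qed
        ultimately show "j' = j" by force
      next
        assume "j' = j"
        moreover have "a (j - 1) < K" if "2 \<le> j"
          using before[of "j - 1"] le[of "j - 1"] that \<open>j \<le> m\<close> by fastforce
        ultimately show "?rise j' \<in> M" using inB[OF jp] j by simp
      qed
      then show ?thesis
        using inA True jp by (intro ex1I[of _ "?rise j"]) (auto simp: A_def B_def)
    qed
  qed
  let ?g = "\<lambda>e. \<Sum>M | perfect_matching ?G M \<and> e \<in> M. monom (1::int) (forcing_number ?G M)"
  have "CHS_poly m k h = sum ?g (A \<union> B)"
    unfolding CHS_poly_def forcing_polynomial_def
    by (rule sum_by_unique_member[OF _ fin unique]) (auto simp: A_def B_def)
  also have "\<dots> = sum ?g A + sum ?g B"
    by (rule sum.union_disjoint) (auto simp: A_def B_def)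
  also have "sum ?g A = (\<Sum>i = h m - 1..K - 1. ?g (vert m i))"
    unfolding A_def by (subst sum.reindex) (auto simp: inj_on_def)
  also have "sum ?g B = (\<Sum>j = p..m. ?g (?rise j))"
    unfolding B_def using p1 by (subst sum.reindex) (auto simp: inj_on_def)
  finally show ?thesis
    using vert_sum rise_sum by (simp add: K_def cong: sum.cong_simp)
qed

end
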